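(* The coverability problem for reset Petri nets with one inhibitor arc is undecidable.
   Context: Multisets over a finite set $S$ are maps $S\to\mathbb{N}$ with pointwise sum $\oplus$ and pointwise order $\preceq$. A reset Petri net with one inhibitor arc is a tuple $(S,T,(I,O,Z),!,\mathbf m_0)$ where $S$ is a finite set of places, $T$ a finite set of transitions, $I,O$ map each transition to a multiset over $S$, $Z(t)\subseteq S$ for each $t\in T$ (reset places), $!\in T\times S$ is a single pair (the inhibitor arc), and $\mathbf m_0$ is the initial marking (a multiset over $S$). A transition $t$ is enabled at marking $\mathbf m$ if $I(t)\preceq\mathbf m$ and, if $!=(t,p)$, then $\mathbf m(p)=0$. Firing an enabled $t$ at $\mathbf m$ yields $\mathbf m'=\mathbf m_2\oplus O(t)$, where $\mathbf m_1\oplus I(t)=\mathbf m$ and $\mathbf m_2(p)=0$ for $p\in Z(t)$, $\mathbf m_2(p)=\mathbf m_1(p)$ otherwise. The coverability problem asks, given such a net and a marking $\mathbf m$, whether some marking $\mathbf m'$ with $\mathbf m\preceq\mathbf m'$ is reachable from $\mathbf m_0$ by a finite sequence of firings. *)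

theory Defs
  imports "HOL-Library.Multiset" "HOL-Library.Nat_Bijection"
begin

section \<open>Reset Petri nets with one inhibitor arc\<close>

record ('p, 't) reset_net =
  places :: "'p set"
  transitions :: "'t set"
  pre :: "'t \<Rightarrow> 'p multiset"
  post :: "'t \<Rightarrow> 'p multiset"
  resets :: "'t \<Rightarrow> 'p set"
  inhibitor :: "'t \<times> 'p"
  init :: "'p multiset"

definition is_marking :: "('p, 't) reset_net \<Rightarrow> 'p multiset \<Rightarrow> bool" where
  "is_marking N m \<longleftrightarrow> set_mset m \<subseteq> places N"

definition reset_inhibitor_net :: "('p, 't) reset_net \<Rightarrow> bool" where
  "reset_inhibitor_net N \<longleftrightarrow>
     finite (places N) \<and> finite (transitions N) \<and>
     (\<forall>t \<in> transitions N.
        is_marking N (pre N t) \<and> is_marking N (post N t) \<and> resets N t \<subseteq> places N) \<and>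
     inhibitor N \<in> transitions N \<times> places N \<and>
     is_marking N (init N)"

definition enabled :: "('p, 't) reset_net \<Rightarrow> 't \<Rightarrow> 'p multiset \<Rightarrow> bool" where
  "enabled N t m \<longleftrightarrow>
     pre N t \<subseteq># m \<and> (\<forall>p. inhibitor N = (t, p) \<longrightarrow> count m p = 0)"

definition fires :: "('p, 't) reset_net \<Rightarrow> 't \<Rightarrow> 'p multiset \<Rightarrow> 'p multiset \<Rightarrow> bool" where
  "fires N t m m' \<longleftrightarrow>
     t \<in> transitions N \<and> enabled N t m \<and>
     (\<exists>m1. m1 + pre N t = m \<and> m' = filter_mset (\<lambda>p. p \<notin> resets N t) m1 + post N t)"

definition reachable :: "('p, 't) reset_net \<Rightarrow> 'p multiset \<Rightarrow> bool" where
  "reachable N m \<longleftrightarrow> (\<lambda>m1 m2. \<exists>t. fires N t m1 m2)\<^sup>*\<^sup>* (init N) m"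

definition coverable :: "('p, 't) reset_net \<Rightarrow> 'p multiset \<Rightarrow> bool" where
  "coverable N m \<longleftrightarrow> (\<exists>m'. reachable N m' \<and> m \<subseteq># m')"


section \<open>Partial recursive functions and decidable problems\<close>

text \<open>
  Kleene's \<open>\<mu>\<close>-recursive functions. \<open>Prec f g\<close> recurses on the first argument, \<open>g\<close> being
  applied to the predecessor, the previous value and the parameters. \<open>rec_eval f xs y\<close> means
  that the function denoted by \<open>f\<close> is defined at \<open>xs\<close> with value \<open>y\<close>; a term applied to an
  argument list of unsuitable length is undefined.
\<close>

datatype recfun =
    Zero
  | Succ
  | Proj nat
  | Comp recfun "recfun list"
  | Prec recfun recfun
  | Mu recfun

inductive rec_eval :: "recfun \<Rightarrow> nat list \<Rightarrow> nat \<Rightarrow> bool" where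
  Zero: "rec_eval Zero xs 0"
| Succ: "rec_eval Succ [x] (Suc x)"
| Proj: "i < length xs \<Longrightarrow> rec_eval (Proj i) xs (xs ! i)"
| Comp: "list_all2 (\<lambda>g y. rec_eval g xs y) gs ys \<Longrightarrow> rec_eval f ys z \<Longrightarrow>
         rec_eval (Comp f gs) xs z"
| Prec_0: "rec_eval f xs y \<Longrightarrow> rec_eval (Prec f g) (0 # xs) y"
| Prec_Suc: "rec_eval (Prec f g) (n # xs) r \<Longrightarrow> rec_eval g (n # r # xs) y \<Longrightarrow>
         rec_eval (Prec f g) (Suc n # xs) y"
| Mu: "rec_eval f (n # xs) 0 \<Longrightarrow> \<forall>k<n. \<exists>y>0. rec_eval f (k # xs) y \<Longrightarrow>
         rec_eval (Mu f) xs n"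

lemma rec_eval_deterministic:
  "rec_eval f xs y \<Longrightarrow> rec_eval f xs y' \<Longrightarrow> y = y'"
proof (induction arbitrary: y' rule: rec_eval.induct)
  case (Comp xs gs ys f z)
  from Comp.prems obtain ys' where
    ys': "list_all2 (\<lambda>g y. rec_eval g xs y) gs ys'" "rec_eval f ys' y'"
    by (cases rule: rec_eval.cases) auto
  have "ys = ys'"
    using Comp.IH(1) ys'(1)
    by (intro nth_equalityI) (auto simp: list_all2_conv_all_nth)
  with Comp.IH(2) ys'(2) show ?case by blast
next
  case (Mu f n xs)
  from Mu.prems have n': "rec_eval f (y' # xs) 0 \<and> (\<forall>k<y'. \<exists>y>0. rec_eval f (k # xs) y)"
    by (cases rule: rec_eval.cases) auto
  show ?case
  proof (rule linorder_cases[of n y'])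
    assume "n < y'"
    with n' obtain y where "y > 0" "rec_eval f (n # xs) y" by blast
    with Mu.IH(1)[of y] show ?thesis by simp
  next
    assume "y' < n"
    with Mu.IH(2) n' show ?thesis by fastforce
  qed simp
next
  case (Prec_Suc f g n xs r y)
  from Prec_Suc.prems obtain r' where "rec_eval (Prec f g) (n # xs) r'" "rec_eval g (n # r' # xs) y'"
    by (cases rule: rec_eval.cases) auto
  with Prec_Suc.IH show ?case by blast
next
  case (Prec_0 f xs y g)
  from Prec_0.prems have "rec_eval f xs y'"
    by (cases rule: rec_eval.cases) auto
  with Prec_0.IH show ?case by blast
qed (erule rec_eval.cases; simp)+

text \<open>
  A decision problem is given by a set \<open>X\<close> of instances, a property \<open>P\<close> of instances and a
  coding of instances by natural numbers. A decision procedure has to halt with the correct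
  answer on the code of every instance; nothing is required on numbers that are not codes.
\<close>

definition decidable_problem :: "'a set \<Rightarrow> ('a \<Rightarrow> bool) \<Rightarrow> ('a \<Rightarrow> nat) \<Rightarrow> bool" where
  "decidable_problem X P code \<longleftrightarrow>
     (\<exists>f. \<forall>x\<in>X. rec_eval f [code x] (if P x then 1 else 0))"


section \<open>Coding of instances\<close>

text \<open>
  Places and transitions of an instance are natural numbers; since both sets are finite, this
  is no restriction up to renaming. Markings are coded as vectors indexed by the places in
  increasing order.
\<close>

type_synonym nat_net = "(nat, nat) reset_net"

definition encode_marking :: "nat_net \<Rightarrow> nat multiset \<Rightarrow> nat" where
  "encode_marking N m = list_encode (map (count m) (sorted_list_of_set (places N)))"

definition encode_transition :: "nat_net \<Rightarrow> nat \<Rightarrow> nat" where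
  "encode_transition N t = list_encode
     [t, encode_marking N (pre N t), encode_marking N (post N t),
      list_encode (sorted_list_of_set (resets N t))]"

definition encode_net :: "nat_net \<Rightarrow> nat" where
  "encode_net N = list_encode
     [list_encode (sorted_list_of_set (places N)),
      list_encode (map (encode_transition N) (sorted_list_of_set (transitions N))),
      fst (inhibitor N), snd (inhibitor N), encode_marking N (init N)]"

definition encode_instance :: "nat_net \<times> nat multiset \<Rightarrow> nat" where
  "encode_instance = (\<lambda>(N, m). prod_encode (encode_net N, encode_marking N m))"

text \<open>
  The code determines the instance, except for the values of \<open>pre\<close>, \<open>post\<close> and \<open>resets\<close>
  outside the set of transitions, which are irrelevant.
\<close>

lemma encode_marking_inject:
  assumes "encode_marking N m = encode_marking N' m'" "places N = places N'"
    and "finite (places N)" "is_marking N m" "is_marking N' m'"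
  shows "m = m'"
proof (rule multiset_eqI)
  fix p
  have "\<forall>p\<in>places N. count m p = count m' p"
    using assms(1-3) by (auto simp: encode_marking_def list_encode_eq)
  then show "count m p = count m' p"
    using assms(2,4,5) unfolding is_marking_def
    by (metis count_eq_zero_iff subsetD)
qed

lemma encode_instance_inject:
  assumes "reset_inhibitor_net N" "is_marking N m"
    and "reset_inhibitor_net N'" "is_marking N' m'"
    and eq: "encode_instance (N, m) = encode_instance (N', m')"
  shows "places N = places N'" "transitions N = transitions N'"
    "\<forall>t\<in>transitions N. pre N t = pre N' t \<and> post N t = post N' t \<and> resets N t = resets N' t"
    "inhibitor N = inhibitor N'" "init N = init N'" "m = m'"
proof -
  note wf = assms(1,3)[unfolded reset_inhibitor_net_def]
  note eqs = eq[unfolded encode_instance_def encode_net_def, simplified, unfolded list_encode_eq, simplified]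
  have fin: "finite (places N)" "finite (places N')" "finite (transitions N)" "finite (transitions N')"
    using wf by auto
  show pl: "places N = places N'"
    using eqs fin by (metis set_sorted_list_of_set)
  have ts: "map (encode_transition N) (sorted_list_of_set (transitions N)) =
            map (encode_transition N') (sorted_list_of_set (transitions N'))"
    using eqs by auto
  have hd: "fst (prod_decode (encode_transition M t - Suc 0)) = t" for M t
    by (simp add: encode_transition_def)
  have "sorted_list_of_set (transitions N) = sorted_list_of_set (transitions N')"
    using arg_cong[OF ts, of "map (\<lambda>c. fst (prod_decode (c - Suc 0)))"] by (simp add: o_def hd)
  then show tr: "transitions N = transitions N'"
    using fin by (metis set_sorted_list_of_set)
  show "inhibitor N = inhibitor N'"
    using eqs by (simp add: prod_eq_iff)
  show "init N = init N'" "m = m'"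
    using eqs wf assms(2,4) pl by (auto intro: encode_marking_inject)
  show "\<forall>t\<in>transitions N. pre N t = pre N' t \<and> post N t = post N' t \<and> resets N t = resets N' t"
  proof
    fix t assume t: "t \<in> transitions N"
    then have "encode_transition N t = encode_transition N' t"
      using ts tr fin by simp
    then have *: "encode_marking N (pre N t) = encode_marking N' (pre N' t)"
      "encode_marking N (post N t) = encode_marking N' (post N' t)"
      "sorted_list_of_set (resets N t) = sorted_list_of_set (resets N' t)"
      unfolding encode_transition_def list_encode_eq by (auto simp: list_encode_eq)
    have "finite (resets N t)" "finite (resets N' t)"
      using wf t tr fin by (metis finite_subset)+
    then have "resets N t = resets N' t"
      using *(3) by (metis set_sorted_list_of_set)
    moreover have "pre N t = pre N' t" "post N t = post N' t"
      using encode_marking_inject[OF *(1) pl fin(1)] encode_marking_inject[OF *(2) pl fin(1)] wf t tr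
      by blast+
    ultimately show "pre N t = pre N' t \<and> post N t = post N' t \<and> resets N t = resets N' t"
      by blast
  qed
qed

end

theory Submission
  imports Defs
begin

text \<open>
  Kleene's functions are computed by loop programs on counters, which are compiled to labelled
  counter machines with zero tests. A reset net simulates such a machine by replacing every zero
  test by a reset; an additional place carries the sum of all counters but is not affected by
  resets. Hence resetting a nonzero counter makes the additional place exceed the sum forever, and
  a final emptiness test on that place, the only inhibitor arc, accepts exactly the honest runs
  that end with empty counters. If \<open>f\<close> decided coverability, let a net compute \<open>f\<close> on an instance
  whose code is assembled from four numbers in the initial marking, and choose these numbers such
  that the instance is this very net: it covers its target if and only if \<open>f\<close> says it does not.
\<close>

lemma filter_mset_ident: "(\<And>x. x \<in># M \<Longrightarrow> P x) \<Longrightarrow> filter_mset P M = M"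
  by (induction M) auto

section \<open>Loop programs\<close>

datatype com = Skip | Inc nat | Seq com com (infixr ";;" 60) | Loop nat com

text \<open>\<open>Loop x c\<close> removes a token from \<open>x\<close> before each pass, and the
  body may put tokens back. It is thus a while loop, as unbounded minimisation requires.\<close>

inductive exec :: "com \<Rightarrow> nat multiset \<Rightarrow> nat multiset \<Rightarrow> bool" where
  Skip: "exec Skip m m"
| Inc: "exec (Inc x) m (add_mset x m)"
| Seq: "exec c m m1 \<Longrightarrow> exec d m1 m2 \<Longrightarrow> exec (c ;; d) m m2"
| Loop_end: "x \<notin># m \<Longrightarrow> exec (Loop x c) m m"
| Loop_step: "exec c m m1 \<Longrightarrow> exec (Loop x c) m1 m2 \<Longrightarrow> exec (Loop x c) (add_mset x m) m2"

text \<open>Invariant rule for a loop with \<open>n\<close> passes: \<open>P j\<close> is the state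
  after \<open>j\<close> passes, without the tokens of \<open>x\<close> still to be consumed.
  Induction on the number of remaining passes.\<close>

lemma exec_Loop_iterate:
  assumes body: "\<And>j. j < n \<Longrightarrow>
      exec c (P j + replicate_mset (n - Suc j) x) (P (Suc j) + replicate_mset (n - Suc j) x)"
    and "x \<notin># P n"
  shows "exec (Loop x c) (P 0 + replicate_mset n x) (P n)"
proof -
  have "exec (Loop x c) (P (n - k) + replicate_mset k x) (P n)" if "k \<le> n" for k
    using that
  proof (induction k)
    case 0
    then show ?case using assms(2) by (simp add: exec.Loop_end)
  next
    case (Suc k)
    then have "Suc (n - Suc k) = n - k" by simp
    with body[of "n - Suc k"] Suc show ?case
      by (auto intro!: exec.Loop_step)
  qed
  from this[of n] show ?thesis by simp
qed

primrec incs :: "nat list \<Rightarrow> com" where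
  "incs [] = Skip"
| "incs (x # xs) = Inc x ;; incs xs"

lemma exec_incs: "exec (incs xs) m (m + mset xs)"
proof (induction xs arbitrary: m)
  case (Cons x xs)
  from Cons[of "add_mset x m"] show ?case
    by (auto intro: exec.intros)
qed (simp add: exec.Skip)

section \<open>Moving, copying and clearing counters\<close>

definition transfer :: "nat \<Rightarrow> nat list \<Rightarrow> com" where
  "transfer x ys = Loop x (incs ys)"

lemma exec_transfer:
  assumes "x \<notin># m" "x \<notin> set ys"
  shows "exec (transfer x ys) (m + replicate_mset n x) (m + repeat_mset n (mset ys))"
proof -
  have "exec (Loop x (incs ys)) (m + repeat_mset 0 (mset ys) + replicate_mset n x)
     (m + repeat_mset n (mset ys))"
  proof (rule exec_Loop_iterate)
    fix j
    show "exec (incs ys) (m + repeat_mset j (mset ys) + replicate_mset (n - Suc j) x)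
      (m + repeat_mset (Suc j) (mset ys) + replicate_mset (n - Suc j) x)"
      using exec_incs[of ys "m + repeat_mset j (mset ys) + replicate_mset (n - Suc j) x"]
      by (simp add: ac_simps)
  next
    show "x \<notin># m + repeat_mset n (mset ys)"
      using assms by (auto simp flip: count_greater_zero_iff)
  qed
  then show ?thesis by (simp add: transfer_def)
qed

lemma exec_clear: "x \<notin># m \<Longrightarrow> exec (transfer x []) (m + replicate_mset n x) m"
  using exec_transfer[of x m "[]" n] by simp

lemma repeat_mset_single: "repeat_mset n {#x#} = replicate_mset n x"
  by (rule multiset_eqI) simp

lemma exec_move:
  "x \<notin># m \<Longrightarrow> x \<noteq> y \<Longrightarrow> exec (transfer x [y]) (m + replicate_mset n x) (m + replicate_mset n y)"
  using exec_transfer[of x m "[y]" n] by (simp add: repeat_mset_single)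

text \<open>A transfer empties its source, so the content of \<open>x\<close> goes to both
  \<open>y\<close> and the scratch counter \<open>z\<close> and then returns from
  \<open>z\<close>.\<close>

definition copy :: "nat \<Rightarrow> nat \<Rightarrow> nat \<Rightarrow> com" where
  "copy x y z = transfer x [y, z] ;; transfer z [x]"

lemma exec_copy:
  assumes "z \<notin># m" "x \<noteq> y" "x \<noteq> z" "y \<noteq> z"
  shows "exec (copy x y z) m (m + replicate_mset (count m x) y)"
proof -
  define n m' where "n = count m x" and "m' = filter_mset (\<lambda>u. u \<noteq> x) m"
  have m: "m = m' + replicate_mset n x"
    by (rule multiset_eqI) (auto simp: n_def m'_def)
  have m': "x \<notin># m'" "z \<notin># m'"
    using assms(1) by (auto simp: m'_def)
  have rep: "repeat_mset n {#y, z#} = replicate_mset n y + replicate_mset n z"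
    by (rule multiset_eqI) simp
  have "exec (transfer x [y, z]) m (m' + replicate_mset n y + replicate_mset n z)"
    using exec_transfer[of x m' "[y, z]" n] m' assms rep by (simp add: m ac_simps)
  moreover have "exec (transfer z [x]) (m' + replicate_mset n y + replicate_mset n z)
      (m' + replicate_mset n y + replicate_mset n x)"
    using m' assms by (intro exec_move) auto
  ultimately show ?thesis
    unfolding copy_def n_def[symmetric] by (subst (2) m) (auto intro: exec.Seq simp: ac_simps)
qed

primrec clear_all :: "nat list \<Rightarrow> com" where
  "clear_all [] = Skip"
| "clear_all (x # xs) = transfer x [] ;; clear_all xs"

lemma exec_clear_all: "exec (clear_all xs) m (filter_mset (\<lambda>x. x \<notin> set xs) m)"
proof (induction xs arbitrary: m)
  case (Cons x xs)
  let ?m = "filter_mset (\<lambda>u. u \<noteq> x) m"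
  have m: "m = ?m + replicate_mset (count m x) x"
    by (rule multiset_eqI) simp
  have "exec (transfer x []) m ?m"
    by (subst m) (rule exec_clear, simp)
  with Cons[of ?m] show ?case
    by (auto intro: exec.Seq simp: filter_filter_mset conj_commute)
qed (simp add: exec.Skip)

section \<open>Computing recursive functions\<close>

text \<open>The list holds compiled programs instead of terms, so that \<open>compute\<close> can
  recurse through \<open>map compute gs\<close>.\<close>

primrec compute_list ::
  "(nat list \<Rightarrow> nat \<Rightarrow> nat \<Rightarrow> com) list \<Rightarrow> nat list \<Rightarrow> nat \<Rightarrow> nat \<Rightarrow> com" where
  "compute_list [] ins out b = Skip"
| "compute_list (h # hs) ins out b = h ins out b ;; compute_list hs ins (Suc out) b"

text \<open>
  \<open>compute f ins out b\<close> adds the value of \<open>f\<close> at the counters \<open>ins\<close> to the counter \<open>out\<close>. The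
  counters from \<open>b\<close> on are work space, which is empty before and after the computation.
\<close>

primrec compute :: "recfun \<Rightarrow> nat list \<Rightarrow> nat \<Rightarrow> nat \<Rightarrow> com" where
  "compute Zero ins out b = Skip"
| "compute Succ ins out b = copy (hd ins) out b ;; Inc out"
| "compute (Proj i) ins out b = copy (ins ! i) out b"
| "compute (Comp f gs) ins out b =
     compute_list (map compute gs) ins b (b + length gs) ;;
     compute f [b..<b + length gs] out (b + length gs) ;;
     clear_all [b..<b + length gs]"
| "compute (Prec f g) ins out b =
     copy (hd ins) (b + 3) b ;;
     compute f (tl ins) (b + 1) (b + 4) ;;
     Loop (b + 3)
       (compute g (b # (b + 1) # tl ins) (b + 2) (b + 4) ;;
        transfer (b + 1) [] ;; transfer (b + 2) [b + 1] ;; Inc b) ;;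
     transfer b [] ;; transfer (b + 1) [out]"
| "compute (Mu f) ins out b =
     Inc (b + 1) ;;
     Loop (b + 1)
       (compute f (b # ins) (b + 2) (b + 3) ;;
        Loop (b + 2) (transfer (b + 2) [] ;; Inc (b + 1) ;; Inc b)) ;;
     transfer b [out]"

text \<open>Quantifying over all placements of inputs, output and work space makes the contract
  usable for nested calls; further contents below \<open>b\<close> must survive.\<close>

definition computes :: "(nat list \<Rightarrow> nat \<Rightarrow> nat \<Rightarrow> com) \<Rightarrow> nat list \<Rightarrow> nat \<Rightarrow> bool" where
  "computes h xs y \<longleftrightarrow> (\<forall>m ins out b.
     map (count m) ins = xs \<longrightarrow> set ins \<subseteq> {..<b} \<longrightarrow> set_mset m \<subseteq> {..<b} \<longrightarrow>
     out < b \<longrightarrow> out \<notin> set ins \<longrightarrow> exec (h ins out b) m (m + replicate_mset y out))"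

lemma computesI:
  assumes "\<And>m ins out b. map (count m) ins = xs \<Longrightarrow> set ins \<subseteq> {..<b} \<Longrightarrow>
    set_mset m \<subseteq> {..<b} \<Longrightarrow> out < b \<Longrightarrow> out \<notin> set ins \<Longrightarrow>
    exec (h ins out b) m (m + replicate_mset y out)"
  shows "computes h xs y"
  using assms unfolding computes_def by blast

lemma computesD:
  assumes "computes h xs y" "map (count m) ins = xs" "set ins \<subseteq> {..<b}"
    "set_mset m \<subseteq> {..<b}" "out < b" "out \<notin> set ins"
  shows "exec (h ins out b) m (m + replicate_mset y out)"
  using assms unfolding computes_def by blast

section \<open>Correctness of the programs for recursive functions\<close>

primrec fill :: "nat \<Rightarrow> nat list \<Rightarrow> nat multiset" where
  "fill p [] = {#}"
| "fill p (y # ys) = replicate_mset y p + fill (Suc p) ys"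

lemma set_fill: "set_mset (fill p ys) \<subseteq> {p..<p + length ys}"
  by (induction ys arbitrary: p) (force split: if_splits)+

lemma count_fill: "i < length ys \<Longrightarrow> count (fill p ys) (p + i) = ys ! i"
proof (induction ys arbitrary: p i)
  case (Cons y ys)
  show ?case
  proof (cases i)
    case 0
    have "p \<notin># fill (Suc p) ys" using set_fill[of "Suc p" ys] by auto
    with 0 show ?thesis by (simp add: not_in_iff)
  next
    case (Suc j)
    with Cons.IH[of j "Suc p"] Cons.prems show ?thesis by simp
  qed
qed simp

text \<open>Each result lands below all counters still to be written, so the remaining programs
  preserve it as part of their state. The inputs lie below the first output and keep their
  values.\<close>

lemma exec_compute_list:
  assumes "list_all2 (\<lambda>h y. computes h xs y) hs ys"
    and "map (count m) ins = xs" "set ins \<subseteq> {..<out}" "set_mset m \<subseteq> {..<out}"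
    and "b = out + length hs"
  shows "exec (compute_list hs ins out b) m (m + fill out ys)"
  using assms
proof (induction arbitrary: m out rule: list_all2_induct)
  case Nil
  then show ?case by (simp add: exec.Skip)
next
  case (Cons h hs y ys)
  let ?m = "m + replicate_mset y out"
  have "exec (h ins out b) m ?m"
    using Cons.prems by (intro computesD[OF Cons.hyps(1)]) auto
  moreover have "exec (compute_list hs ins (Suc out) b) ?m (?m + fill (Suc out) ys)"
    using Cons.prems by (intro Cons.IH) auto
  ultimately show ?case
    by (auto intro: exec.Seq simp: ac_simps)
qed

lemma computes_Comp:
  assumes "list_all2 (\<lambda>g y. computes (compute g) xs y) gs ys" "computes (compute f) ys z"
  shows "computes (compute (Comp f gs)) xs z"
proof (rule computesI)
  fix m ins and out b :: nat
  assume a: "map (count m) ins = xs" "set ins \<subseteq> {..<b}" "set_mset m \<subseteq> {..<b}" "out < b"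
    "out \<notin> set ins"
  let ?n = "length gs"
  have n: "length ys = ?n"
    using assms(1) by (simp add: list_all2_lengthD)
  have "exec (compute_list (map compute gs) ins b (b + ?n)) m (m + fill b ys)"
    using assms(1) a by (intro exec_compute_list) (auto simp: list_all2_map1)
  moreover have "exec (compute f [b..<b + ?n] out (b + ?n)) (m + fill b ys)
      (m + fill b ys + replicate_mset z out)"
  proof (rule computesD[OF assms(2)])
    show "map (count (m + fill b ys)) [b..<b + ?n] = ys"
    proof (rule nth_equalityI)
      fix i assume "i < length (map (count (m + fill b ys)) [b..<b + ?n])"
      then have i: "i < ?n" by simp
      have "b + i \<notin># m" using a by auto
      with i n show "map (count (m + fill b ys)) [b..<b + ?n] ! i = ys ! i"
        by (simp add: count_fill not_in_iff)
    qed (simp add: n)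
    show "set_mset (m + fill b ys) \<subseteq> {..<b + ?n}"
      using a set_fill[of b ys] n by force
  qed (use a in auto)
  moreover have "exec (clear_all [b..<b + ?n]) (m + fill b ys + replicate_mset z out)
     (m + replicate_mset z out)"
  proof -
    \<comment> \<open>Clearing the block removes exactly the intermediate results, since
      \<open>m\<close> and \<open>out\<close> lie below \<open>b\<close>.\<close>
    let ?F = "filter_mset (\<lambda>x. x \<notin> set [b..<b + ?n])"
    let ?m = "m + replicate_mset z out"
    have fill: "?F (fill b ys) = {#}"
      using set_fill[of b ys] n by force
    have m: "?F ?m = ?m"
      using a by (intro filter_mset_ident) (auto split: if_splits)
    have "?F (?m + fill b ys) = ?m"
      unfolding filter_union_mset[of _ ?m] fill m by simp
    then have "?F (m + fill b ys + replicate_mset z out) = ?m"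
      by (simp only: ac_simps)
    with exec_clear_all[of "[b..<b + ?n]" "m + fill b ys + replicate_mset z out"]
    show ?thesis by simp
  qed
  ultimately show "exec (compute (Comp f gs) ins out b) m (m + replicate_mset z out)"
    by (auto intro: exec.Seq)
qed

text \<open>Counter \<open>b\<close> holds the index \<open>j\<close>, \<open>b + 1\<close> the
  value \<open>v j\<close>, \<open>b + 2\<close> receives \<open>v (Suc j)\<close>, and
  \<open>b + 3\<close> holds the number of passes left.\<close>

lemma computes_Prec:
  assumes f: "computes (compute f) xs (v 0)"
    and g: "\<And>j. j < n \<Longrightarrow> computes (compute g) (j # v j # xs) (v (Suc j))"
  shows "computes (compute (Prec f g)) (n # xs) (v n)"
proof (rule computesI)
  fix m ins and out b :: nat
  assume a: "map (count m) ins = n # xs" "set ins \<subseteq> {..<b}" "set_mset m \<subseteq> {..<b}" "out < b"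
    "out \<notin> set ins"
  then obtain i js where ins: "ins = i # js" and i: "count m i = n" and js: "map (count m) js = xs"
    by (cases ins) auto
  have fresh: "b + k \<notin># m" "b + k \<notin> set js" for k
    using a ins by auto
  from fresh[of 0] have fresh0: "b \<notin># m" "b \<notin> set js" by simp_all
  define P where "P j = m + replicate_mset j b + replicate_mset (v j) (b + 1)" for j
  have "exec (copy (hd ins) (b + 3) b) m (m + replicate_mset n (b + 3))"
    using exec_copy[of b m i "b + 3"] a ins i fresh0 by auto
  moreover have "exec (compute f (tl ins) (b + 1) (b + 4)) (m + replicate_mset n (b + 3))
      (P 0 + replicate_mset n (b + 3))"
  proof -
    have "map (count (m + replicate_mset n (b + 3))) js = xs"
      using js fresh by auto
    moreover have "set js \<subseteq> {..<b + 4}" "set_mset (m + replicate_mset n (b + 3)) \<subseteq> {..<b + 4}"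
      using a ins by (force split: if_splits)+
    ultimately show ?thesis
      using computesD[OF f, of "m + replicate_mset n (b + 3)" js "b + 4" "b + 1"] fresh(2)[of 1]
      by (simp add: ins P_def ac_simps)
  qed
  moreover have "exec (Loop (b + 3)
       (compute g (b # (b + 1) # tl ins) (b + 2) (b + 4) ;;
        transfer (b + 1) [] ;; transfer (b + 2) [b + 1] ;; Inc b)) (P 0 + replicate_mset n (b + 3))
       (P n)"
  proof (rule exec_Loop_iterate)
    fix j assume j: "j < n"
    let ?R = "replicate_mset (n - Suc j) (b + 3)"
    let ?m = "m + replicate_mset j b + ?R"
    have "map (count (P j + ?R)) (b # (b + 1) # js) = j # v j # xs"
    proof -
      have "map (count (P j + ?R)) js = xs"
        using js fresh(2)[of 1] fresh(2)[of 3] fresh0 by (auto simp: P_def)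
      then show ?thesis
        using fresh[of 0] fresh[of 1] by (auto simp: P_def not_in_iff)
    qed
    moreover have "set (b # (b + 1) # js) \<subseteq> {..<b + 4}" "set_mset (P j + ?R) \<subseteq> {..<b + 4}"
      using a ins by (force simp: P_def split: if_splits)+
    ultimately have "exec (compute g (b # (b + 1) # js) (b + 2) (b + 4)) (P j + ?R)
       (P j + ?R + replicate_mset (v (Suc j)) (b + 2))"
      using fresh(2)[of 2] by (intro computesD[OF g[OF j]]) auto
    moreover have "exec (transfer (b + 1) []) (P j + ?R + replicate_mset (v (Suc j)) (b + 2))
       (?m + replicate_mset (v (Suc j)) (b + 2))"
      using exec_clear[of "b + 1" "?m + replicate_mset (v (Suc j)) (b + 2)" "v j"] fresh(1)[of 1]
      by (simp add: P_def ac_simps)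
    moreover have "exec (transfer (b + 2) [b + 1]) (?m + replicate_mset (v (Suc j)) (b + 2))
       (?m + replicate_mset (v (Suc j)) (b + 1))"
      using fresh(1)[of 2] by (intro exec_move) auto
    moreover have "exec (Inc b) (?m + replicate_mset (v (Suc j)) (b + 1)) (P (Suc j) + ?R)"
      using exec.Inc[of b "?m + replicate_mset (v (Suc j)) (b + 1)"] by (simp add: P_def ac_simps)
    ultimately show "exec (compute g (b # (b + 1) # tl ins) (b + 2) (b + 4) ;;
        transfer (b + 1) [] ;; transfer (b + 2) [b + 1] ;; Inc b) (P j + ?R) (P (Suc j) + ?R)"
      unfolding ins list.sel by (blast intro: exec.Seq)
  qed (use fresh(1)[of 3] in \<open>auto simp: P_def\<close>)
  moreover have "exec (transfer b []) (P n) (m + replicate_mset (v n) (b + 1))"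
    using exec_clear[of b "m + replicate_mset (v n) (b + 1)" n] fresh(1)[of 0]
    by (simp add: P_def ac_simps)
  moreover have "exec (transfer (b + 1) [out]) (m + replicate_mset (v n) (b + 1))
      (m + replicate_mset (v n) out)"
    using fresh(1)[of 1] a by (intro exec_move) auto
  ultimately show "exec (compute (Prec f g) ins out b) m (m + replicate_mset (v n) out)"
    unfolding compute.simps by (blast intro: exec.Seq)
qed

text \<open>Counter \<open>b\<close> holds the candidate, \<open>b + 1\<close> is a flag that keeps
  the search going, and \<open>b + 2\<close> receives the value of \<open>f\<close>. The inner loop
  acts as a conditional: a positive value is erased in one pass, which sets the flag again and
  advances the candidate.\<close>

lemma computes_Mu:
  assumes f: "\<And>j. j \<le> n \<Longrightarrow> computes (compute f) (j # xs) (v j)"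
    and v: "v n = 0" "\<And>j. j < n \<Longrightarrow> v j > 0"
  shows "computes (compute (Mu f)) xs n"
proof (rule computesI)
  fix m ins and out b :: nat
  assume a: "map (count m) ins = xs" "set ins \<subseteq> {..<b}" "set_mset m \<subseteq> {..<b}" "out < b"
    "out \<notin> set ins"
  have fresh: "b + k \<notin># m" "b + k \<notin> set ins" for k
    using a by auto
  from fresh[of 0] have fresh0: "b \<notin># m" "b \<notin> set ins" by simp_all
  define Q where "Q j = m + replicate_mset j b" for j
  let ?test = "Loop (b + 2) (transfer (b + 2) [] ;; Inc (b + 1) ;; Inc b)"
  let ?body = "compute f (b # ins) (b + 2) (b + 3) ;; ?test"
  have f_run: "exec (compute f (b # ins) (b + 2) (b + 3)) (Q j) (Q j + replicate_mset (v j) (b + 2))"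
    if "j \<le> n" for j
  proof (rule computesD[OF f[OF that]])
    show "map (count (Q j)) (b # ins) = j # xs"
      using a fresh0 by (auto simp: Q_def not_in_iff)
    show "set (b # ins) \<subseteq> {..<b + 3}" "set_mset (Q j) \<subseteq> {..<b + 3}" "b + 2 \<notin> set (b # ins)"
      using a by (force simp: Q_def split: if_splits)+
  qed simp
  have test: "exec ?test (Q j + replicate_mset (v j) (b + 2)) (add_mset (b + 1) (Q (Suc j)))"
    if "j < n" for j
  proof -
    from v(2)[OF that] obtain k where k: "v j = Suc k" by (cases "v j") auto
    have Q2: "b + 2 \<notin># Q i" for i using fresh(1)[of 2] by (auto simp: Q_def)
    have "exec (transfer (b + 2) []) (Q j + replicate_mset k (b + 2)) (Q j)"
      by (rule exec_clear[OF Q2])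
    moreover have "exec (Inc b) (add_mset (b + 1) (Q j)) (add_mset (b + 1) (Q (Suc j)))"
      using exec.Inc[of b "add_mset (b + 1) (Q j)"] by (simp add: Q_def ac_simps add_mset_commute)
    ultimately have "exec (transfer (b + 2) [] ;; Inc (b + 1) ;; Inc b)
       (Q j + replicate_mset k (b + 2)) (add_mset (b + 1) (Q (Suc j)))"
      by (blast intro: exec.intros)
    moreover have "exec ?test (add_mset (b + 1) (Q (Suc j))) (add_mset (b + 1) (Q (Suc j)))"
      using Q2 by (intro exec.Loop_end) auto
    ultimately show ?thesis
      by (simp add: k exec.Loop_step)
  qed
  \<comment> \<open>\<open>k\<close> counts the candidates still to be rejected. For
    \<open>k = 0\<close> the value is 0, the inner loop is skipped and the flag stays
    cleared.\<close>
  have "exec (Loop (b + 1) ?body) (add_mset (b + 1) (Q (n - k))) (Q n)" if "k \<le> n" for k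
    using that
  proof (induction k)
    case 0
    have "exec ?body (Q n) (Q n)"
      using f_run[of n] v fresh(1)[of 2]
      by (auto simp: Q_def intro!: exec.intros split: if_splits)
    moreover have "exec (Loop (b + 1) ?body) (Q n) (Q n)"
      using fresh(1)[of 1] by (intro exec.Loop_end) (auto simp: Q_def)
    ultimately show ?case by (simp add: exec.Loop_step)
  next
    case (Suc k)
    then have "exec ?body (Q (n - Suc k)) (add_mset (b + 1) (Q (n - k)))"
      using f_run[of "n - Suc k"] test[of "n - Suc k"]
      by (auto intro!: exec.Seq simp: Suc_diff_Suc)
    with Suc show ?case by (simp add: exec.Loop_step)
  qed
  from this[of n] have "exec (Loop (b + 1) ?body) (add_mset (b + 1) m) (Q n)"
    by (simp add: Q_def)
  moreover have "exec (transfer b [out]) (Q n) (m + replicate_mset n out)"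
    unfolding Q_def using fresh0 a by (intro exec_move) auto
  ultimately show "exec (compute (Mu f) ins out b) m (m + replicate_mset n out)"
    unfolding compute.simps by (blast intro: exec.intros)
qed

text \<open>Induction on the term, not on the derivation: \<open>Prec\<close> and \<open>Mu\<close>
  need the hypothesis at all argument lists of an iteration, whose values are first extracted from
  the derivation.\<close>

lemma computes_rec_eval: "rec_eval f xs y \<Longrightarrow> computes (compute f) xs y"
proof (induction f arbitrary: xs y)
  case Zero
  then have "y = 0" by (cases rule: rec_eval.cases) auto
  then show ?case by (auto intro!: computesI exec.Skip)
next
  case Succ
  then obtain x where x: "xs = [x]" "y = Suc x" by (cases rule: rec_eval.cases) auto
  show ?case
  proof (rule computesI)
    fix m ins and out b :: nat
    assume a: "map (count m) ins = xs" "set ins \<subseteq> {..<b}" "set_mset m \<subseteq> {..<b}" "out < b"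
      "out \<notin> set ins"
    with x obtain i where i: "ins = [i]" "count m i = x" by auto
    have "exec (copy i out b) m (m + replicate_mset x out)"
      using exec_copy[of b m i out] a i by force
    then have "exec (copy i out b ;; Inc out) m (add_mset out (m + replicate_mset x out))"
      by (blast intro: exec.intros)
    with x i show "exec (compute Succ ins out b) m (m + replicate_mset y out)" by simp
  qed
next
  case (Proj i)
  then have i: "i < length xs" "y = xs ! i" by (cases rule: rec_eval.cases; simp)+
  show ?case
  proof (rule computesI)
    fix m ins and out b :: nat
    assume a: "map (count m) ins = xs" "set ins \<subseteq> {..<b}" "set_mset m \<subseteq> {..<b}" "out < b"
      "out \<notin> set ins"
    with i have "ins ! i \<in> set ins" "count m (ins ! i) = y" by auto
    with a exec_copy[of b m "ins ! i" out]
    show "exec (compute (Proj i) ins out b) m (m + replicate_mset y out)" by force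
  qed
next
  case (Comp f gs)
  from Comp.prems obtain ys where ys: "list_all2 (\<lambda>g y. rec_eval g xs y) gs ys" "rec_eval f ys y"
    by (cases rule: rec_eval.cases) auto
  have "list_all2 (\<lambda>g y. computes (compute g) xs y) gs ys"
    using ys(1) Comp.IH(2) by (auto simp: list_all2_conv_all_nth)
  with Comp.IH(1)[OF ys(2)] show ?case by (rule computes_Comp[rotated])
next
  case (Prec f g)
  from Prec.prems obtain n zs where xs: "xs = n # zs"
    by (cases rule: rec_eval.cases) auto
  have pred: "\<exists>r. rec_eval (Prec f g) (j # zs) r \<and> rec_eval g (j # r # zs) z"
    if "rec_eval (Prec f g) (Suc j # zs) z" for j z
    using that by (cases rule: rec_eval.cases) auto
  \<comment> \<open>Definedness descends from \<open>n\<close>, because each value is derived from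
    its predecessor.\<close>
  have "\<exists>r. rec_eval (Prec f g) (j # zs) r" if "j \<le> n" for j
    using that
  proof (induction rule: inc_induct)
    case base
    then show ?case using Prec.prems xs by blast
  qed (use pred in blast)
  then obtain v where v: "\<And>j. j \<le> n \<Longrightarrow> rec_eval (Prec f g) (j # zs) (v j)"
    by metis
  have "rec_eval f zs (v 0)"
    using v[of 0] by (cases rule: rec_eval.cases) auto
  moreover have "rec_eval g (j # v j # zs) (v (Suc j))" if "j < n" for j
    using that v[of j] pred[OF v[of "Suc j"]] rec_eval_deterministic by fastforce
  ultimately have "computes (compute (Prec f g)) (n # zs) (v n)"
    by (intro computes_Prec Prec.IH)
  moreover have "v n = y"
    using v[of n] Prec.prems xs rec_eval_deterministic by blast
  ultimately show ?case by (simp only: xs)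
next
  case (Mu f)
  from Mu.prems have "rec_eval f (y # xs) 0" "\<forall>k<y. \<exists>z>0. rec_eval f (k # xs) z"
    by (cases rule: rec_eval.cases; auto)+
  \<comment> \<open>\<open>v\<close> gives the positive values below \<open>y\<close>;
    \<open>v(y := 0)\<close> adds the final zero.\<close>
  then obtain v where "\<And>j. j < y \<Longrightarrow> v j > 0 \<and> rec_eval f (j # xs) (v j)"
    by metis
  with \<open>rec_eval f (y # xs) 0\<close> show ?case
    by (intro computes_Mu[where v = "v(y := 0)"] Mu.IH) (auto simp: le_less)
qed

section \<open>Counter machines\<close>

text \<open>
  \<open>Instr q A B Z q'\<close> leads from label \<open>q\<close> to label \<open>q'\<close>, removing \<open>A\<close> from the counters, testing
  the counters in \<open>Z\<close> for zero and adding \<open>B\<close>.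
\<close>

datatype instr = Instr nat "nat multiset" "nat multiset" "nat set" nat

text \<open>The test sees what remains after \<open>A\<close> is removed, the same moment at which a
  firing applies its resets.\<close>

inductive step :: "instr set \<Rightarrow> nat \<times> nat multiset \<Rightarrow> nat \<times> nat multiset \<Rightarrow> bool" for I where
  step: "Instr q A B Z q' \<in> I \<Longrightarrow> set_mset m \<inter> Z = {} \<Longrightarrow> step I (q, m + A) (q', m + B)"

text \<open>Code placed at \<open>p\<close> has its instructions at labels from \<open>p\<close> up
  to, but excluding, the exit label, where subsequent code begins.\<close>

primrec exit_label :: "com \<Rightarrow> nat \<Rightarrow> nat" where
  "exit_label Skip p = p"
| "exit_label (Inc x) p = Suc p"
| "exit_label (c ;; d) p = exit_label d (exit_label c p)"
| "exit_label (Loop x c) p = Suc (exit_label c (Suc p))"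

text \<open>The counters are shifted by one since the number 0 is reserved for the sum of all counters.\<close>

primrec instrs :: "com \<Rightarrow> nat \<Rightarrow> instr list" where
  "instrs Skip p = []"
| "instrs (Inc x) p = [Instr p {#} {#Suc x#} {} (Suc p)]"
| "instrs (c ;; d) p = instrs c p @ instrs d (exit_label c p)"
| "instrs (Loop x c) p =
     Instr p {#Suc x#} {#} {} (Suc p) #
     Instr p {#} {#} {Suc x} (Suc (exit_label c (Suc p))) #
     Instr (exit_label c (Suc p)) {#} {#} {} p #
     instrs c (Suc p)"

lemma steps_exec:
  assumes "exec c m m'" "set (instrs c p) \<subseteq> I"
  shows "(step I)\<^sup>*\<^sup>* (p, image_mset Suc m) (exit_label c p, image_mset Suc m')"
  using assms
proof (induction arbitrary: p rule: exec.induct)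
  case (Skip m)
  then show ?case by simp
next
  case (Inc x m)
  then show ?case
    using step[of p "{#}" "{#Suc x#}" "{}" "Suc p" I "image_mset Suc m"] by auto
next
  case (Seq c m m1 d m2)
  then have "(step I)\<^sup>*\<^sup>* (p, image_mset Suc m) (exit_label c p, image_mset Suc m1)"
    "(step I)\<^sup>*\<^sup>* (exit_label c p, image_mset Suc m1)
       (exit_label d (exit_label c p), image_mset Suc m2)"
    by simp_all
  then show ?case by simp
next
  case (Loop_end x m c)
  then show ?case
    using step[of p "{#}" "{#}" "{Suc x}" "Suc (exit_label c (Suc p))" I "image_mset Suc m"] by auto
next
  case (Loop_step c m m1 x m2)
  have "step I (p, image_mset Suc (add_mset x m)) (Suc p, image_mset Suc m)"
    using step[of p "{#Suc x#}" "{#}" "{}" "Suc p" I "image_mset Suc m"] Loop_step.prems by auto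
  also have "(step I)\<^sup>*\<^sup>* (Suc p, image_mset Suc m) (exit_label c (Suc p), image_mset Suc m1)"
    using Loop_step by simp
  also have "step I (exit_label c (Suc p), image_mset Suc m1) (p, image_mset Suc m1)"
    using step[of "exit_label c (Suc p)" "{#}" "{#}" "{}" p I "image_mset Suc m1"]
      Loop_step.prems by auto
  also have "(step I)\<^sup>*\<^sup>* (p, image_mset Suc m1) (exit_label (Loop x c) p, image_mset Suc m2)"
    using Loop_step by blast
  finally show ?case .
qed

section \<open>Label ranges and determinism of compiled programs\<close>

lemma exit_label_ge: "p \<le> exit_label c p"
proof (induction c arbitrary: p)
  case (Seq c d)
  from Seq(1)[of p] Seq(2)[of "exit_label c p"] show ?case by simp
next
  case (Loop x c)
  from Loop[of "Suc p"] show ?case by simp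
qed simp_all

lemma instrs_source: "Instr q A B Z q' \<in> set (instrs c p) \<Longrightarrow> p \<le> q \<and> q < exit_label c p"
proof (induction c arbitrary: p)
  case (Seq c d)
  with exit_label_ge[of p c] exit_label_ge[of "exit_label c p" d] show ?case
    by fastforce
next
  case (Loop x c)
  with exit_label_ge[of "Suc p" c] show ?case by fastforce
qed auto

lemma step_source: "step (set (instrs c p)) (q, m) s \<Longrightarrow> p \<le> q \<and> q < exit_label c p"
  by (auto elim!: step.cases dest: instrs_source)

lemma step_Un: "step (I \<union> J) s s' \<longleftrightarrow> step I s s' \<or> step J s s'"
  by (auto intro: step.intros elim!: step.cases)

text \<open>Subprograms occupy disjoint label ranges. The only label with two instructions of its
  own is a loop head, and these exclude each other: one takes a token from the counter that the
  other tests for zero.\<close>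

lemma step_deterministic:
  "step (set (instrs c p)) s s1 \<Longrightarrow> step (set (instrs c p)) s s2 \<Longrightarrow> s1 = s2"
proof (induction c arbitrary: p)
  case Skip
  then show ?case by (auto elim: step.cases)
next
  case (Inc x)
  then show ?case by (auto elim!: step.cases)
next
  case (Seq c d)
  obtain q m where s: "s = (q, m)" by (cases s)
  have "\<not> (step (set (instrs c p)) s t \<and> step (set (instrs d (exit_label c p))) s t')" for t t'
    using step_source[of c p q m] step_source[of d "exit_label c p" q m] unfolding s by fastforce
  with Seq show ?case unfolding instrs.simps set_append step_Un by blast
next
  case (Loop x c)
  obtain q m where s: "s = (q, m)" by (cases s)
  let ?e = "exit_label c (Suc p)"
  let ?H = "{Instr p {#Suc x#} {#} {} (Suc p), Instr p {#} {#} {Suc x} (Suc ?e),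
    Instr ?e {#} {#} {} p}"
  have *: "set (instrs (Loop x c) p) = ?H \<union> set (instrs c (Suc p))" by auto
  have H: "t = t'" if "step ?H s t" "step ?H s t'" for t t'
    using that exit_label_ge[of "Suc p" c] by (auto elim!: step.cases)
  have "\<not> (step ?H s t \<and> step (set (instrs c (Suc p))) s t')" for t t'
  \<comment> \<open>The loop head \<open>p\<close> and the label \<open>?e\<close> of the jump back
    lie just outside the half-open label range of the body.\<close>
  proof
    assume a: "step ?H s t \<and> step (set (instrs c (Suc p))) s t'"
    then have "q = p \<or> q = ?e" unfolding s by (auto elim!: step.cases)
    with a step_source[of c "Suc p" q m t'] s show False by auto
  qed
  with Loop H show ?case unfolding * step_Un by blast
qed

text \<open>Lets one known halting run determine the outcome of every halting run from the same
  state.\<close>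

lemma steps_stuck_unique:
  assumes "\<And>s s1 s2. r s s1 \<Longrightarrow> r s s2 \<Longrightarrow> s1 = s2"
    and "r\<^sup>*\<^sup>* s t" "\<And>u. \<not> r t u" "r\<^sup>*\<^sup>* s t'" "\<And>u. \<not> r t' u"
  shows "t = t'"
  using assms(2,4)
proof (induction rule: converse_rtranclp_induct)
  case base
  then show ?case using assms(3) by (auto elim: converse_rtranclpE)
next
  case (step s s')
  from step.prems have "r\<^sup>*\<^sup>* s' t'"
  proof (cases rule: converse_rtranclpE)
    case base
    then show ?thesis using assms(5) step.hyps by blast
  next
    case (step y)
    then show ?thesis using assms(1) \<open>r s s'\<close> by blast
  qed
  then show ?case by (rule step.IH)
qed

section \<open>Separating counters from labels\<close>

primrec counters :: "com \<Rightarrow> nat set" where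
  "counters Skip = {}"
| "counters (Inc x) = {x}"
| "counters (c ;; d) = counters c \<union> counters d"
| "counters (Loop x c) = insert x (counters c)"

lemma finite_counters: "finite (counters c)"
  by (induction c) auto

text \<open>Counters and labels become places of one net, so \<open>K\<close> separates them.
  Excluding 0 protects the sum place from resets.\<close>

definition wf_instr :: "nat \<Rightarrow> nat \<Rightarrow> instr \<Rightarrow> bool" where
  "wf_instr K e i \<longleftrightarrow> (case i of Instr q A B Z q' \<Rightarrow>
     {q, q'} \<subseteq> {K..e} \<and> set_mset A \<union> set_mset B \<union> Z \<subseteq> {0<..<K})"

lemma wf_instrs:
  assumes "K \<le> p" "exit_label c p \<le> e" "Suc ` counters c \<subseteq> {..<K}" "i \<in> set (instrs c p)"
  shows "wf_instr K e i"
  using assms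
proof (induction c arbitrary: p)
  case (Seq c d)
  from Seq.prems(4) consider "i \<in> set (instrs c p)" | "i \<in> set (instrs d (exit_label c p))" by auto
  then show ?case
  proof cases
    case 1
    then show ?thesis using Seq.prems exit_label_ge[of "exit_label c p" d]
      by (intro Seq.IH(1)[of p]) auto
  next
    case 2
    then show ?thesis using Seq.prems exit_label_ge[of p c]
      by (intro Seq.IH(2)[of "exit_label c p"]) auto
  qed
next
  case (Loop x c)
  then show ?case
    using Loop.IH[of "Suc p"] exit_label_ge[of "Suc p" c] by (auto simp: wf_instr_def)
qed (auto simp: wf_instr_def)

section \<open>Simulation by a reset net with one inhibitor arc\<close>

text \<open>
  Place 0 carries the sum of all counters; transition 0 moves from the exit label to the target
  place \<open>Suc e\<close> if place 0 is empty.
\<close>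

definition weighted :: "nat \<Rightarrow> nat multiset \<Rightarrow> nat multiset" where
  "weighted q m = add_mset q (m + replicate_mset (size m) 0)"

definition net :: "instr list \<Rightarrow> nat \<Rightarrow> nat multiset \<Rightarrow> nat_net" where
  "net prog e M0 =
    \<lparr>places = {..<e + 2}, transitions = {..<Suc (length prog)},
     pre = (\<lambda>t. case t of 0 \<Rightarrow> {#e#} | Suc i \<Rightarrow> (case prog ! i of Instr q A B Z q' \<Rightarrow> weighted q A)),
     post = (\<lambda>t. case t of 0 \<Rightarrow> {#Suc e#} | Suc i \<Rightarrow>
       (case prog ! i of Instr q A B Z q' \<Rightarrow> weighted q' B)),
     resets = (\<lambda>t. case t of 0 \<Rightarrow> {} | Suc i \<Rightarrow> (case prog ! i of Instr q A B Z q' \<Rightarrow> Z)),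
     inhibitor = (0, 0), init = M0\<rparr>"

lemma reset_inhibitor_net_net:
  assumes wf: "\<And>i. i \<in> set prog \<Longrightarrow> wf_instr K e i" and "K \<le> e" "set_mset M0 \<subseteq> {..<e + 2}"
  shows "reset_inhibitor_net (net prog e M0)"
proof -
  have "is_marking (net prog e M0) (pre (net prog e M0) t) \<and> is_marking (net prog e M0) (post (net prog e M0) t)
     \<and> resets (net prog e M0) t \<subseteq> places (net prog e M0)" if "t < Suc (length prog)" for t
  proof (cases t)
    case 0
    then show ?thesis by (simp add: net_def is_marking_def)
  next
    case (Suc j)
    obtain q A B Z q' where i: "prog ! j = Instr q A B Z q'" by (cases "prog ! j")
    have "Instr q A B Z q' \<in> set prog" using i Suc that by (metis Suc_less_SucD nth_mem)
    from wf[OF this] Suc i show ?thesis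
      by (force simp: net_def is_marking_def wf_instr_def weighted_def split: if_splits)
  qed
  then show ?thesis
    using assms unfolding reset_inhibitor_net_def
    by (auto simp: is_marking_def net_def)
qed

text \<open>In an honest run every reset meets empty counters, so the sum place stays exact and is
  empty once all counters are.\<close>

lemma net_complete:
  assumes wf: "\<And>i. i \<in> set prog \<Longrightarrow> wf_instr K e i"
    and "0 < e"
    and run: "(step (set prog))\<^sup>*\<^sup>* (p, m0) (e, {#})"
  shows "coverable (net prog e (weighted p m0)) {#Suc e#}"
proof -
  let ?N = "net prog e (weighted p m0)"
  let ?r = "\<lambda>M M'. \<exists>t. fires ?N t M M'"
  have one: "?r (weighted q m) (weighted q' m')" if st: "step (set prog) (q, m) (q', m')" for q m q' m'
  proof -
    from st obtain A B Z m1 where i: "Instr q A B Z q' \<in> set prog" and d: "set_mset m1 \<inter> Z = {}"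
      and m: "m = m1 + A" "m' = m1 + B"
      by (auto elim!: step.cases)
    from i obtain j where j: "j < length prog" "prog ! j = Instr q A B Z q'"
      by (metis in_set_conv_nth)
    have "0 \<notin> Z" using wf[OF i] by (auto simp: wf_instr_def)
    let ?m = "m1 + replicate_mset (size m1) 0"
    have "filter_mset (\<lambda>p. p \<notin> Z) ?m = ?m"
      using d \<open>0 \<notin> Z\<close> by (intro filter_mset_ident) (auto split: if_splits)
    moreover have "weighted q m = ?m + weighted q A" "weighted q' m' = ?m + weighted q' B"
      by (rule multiset_eqI, simp add: weighted_def m)+
    ultimately have "fires ?N (Suc j) (weighted q m) (weighted q' m')"
      using j unfolding fires_def enabled_def by (simp add: net_def del: filter_union_mset)
    then show ?thesis by blast
  qed
  have "?r\<^sup>*\<^sup>* (weighted p m0) (case_prod weighted s)" if "(step (set prog))\<^sup>*\<^sup>* (p, m0) s" for s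
    using that
  proof induction
    case (step s s')
    then show ?case
      using one[of "fst s" "snd s" "fst s'" "snd s'"]
      by (auto simp: case_prod_beta intro: rtranclp.rtrancl_into_rtrancl)
  qed simp
  from this[OF run] have "?r\<^sup>*\<^sup>* (weighted p m0) (weighted e {#})" by simp
  \<comment> \<open>\<open>0 < e\<close> ensures that the label token itself does not sit on the
    inhibiting place.\<close>
  moreover have "fires ?N 0 (weighted e {#}) {#Suc e#}"
    using \<open>0 < e\<close> by (auto simp: fires_def enabled_def net_def weighted_def)
  ultimately have "?r\<^sup>*\<^sup>* (weighted p m0) {#Suc e#}"
    by (auto intro: rtranclp.rtrancl_into_rtrancl)
  moreover have "init ?N = weighted p m0" by (simp add: net_def)
  ultimately show ?thesis
    unfolding coverable_def reachable_def by auto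
qed

text \<open>
  \<open>d\<close> counts the tokens that were lost by resetting nonempty places. It never decreases, and
  place 0 can only be emptied if it is zero.
\<close>

lemma net_sound:
  assumes wf: "\<And>i. i \<in> set prog \<Longrightarrow> wf_instr K e i"
    and K: "0 < K" "p \<in> {K..e}" "set_mset m0 \<subseteq> {0<..<K}"
    and cov: "coverable (net prog e (weighted p m0)) {#Suc e#}"
  shows "(step (set prog))\<^sup>*\<^sup>* (p, m0) (e, {#})"
proof (rule ccontr)
  \<comment> \<open>Under this assumption transition 0 never fires, so the invariant need not
    describe a marked target place.\<close>
  assume no_run: "\<not> (step (set prog))\<^sup>*\<^sup>* (p, m0) (e, {#})"
  let ?N = "net prog e (weighted p m0)"
  define inv where "inv M \<longleftrightarrow> (\<exists>q m d. M = add_mset q (m + replicate_mset (size m + d) 0) \<and>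
    q \<in> {K..e} \<and> set_mset m \<subseteq> {0<..<K} \<and>
    (d = 0 \<longrightarrow> (step (set prog))\<^sup>*\<^sup>* (p, m0) (q, m)))" for M
  have inv_step: "inv M'" if "inv M" and fires: "fires ?N t M M'" for t M M'
  proof -
    from \<open>inv M\<close> obtain q m d where M: "M = add_mset q (m + replicate_mset (size m + d) 0)"
      and q: "q \<in> {K..e}" and m: "set_mset m \<subseteq> {0<..<K}"
      and run: "d = 0 \<Longrightarrow> (step (set prog))\<^sup>*\<^sup>* (p, m0) (q, m)"
      unfolding inv_def by blast
    show ?thesis
    proof (cases t)
      case 0
      with fires have "e \<in># M" "0 \<notin># M"
        by (auto simp: fires_def enabled_def net_def not_in_iff)
      \<comment> \<open>An empty place 0 forces \<open>size m + d = 0\<close>, so the run was honest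
        and ended with empty counters.\<close>
      then have "q = e" "m = {#}" "d = 0"
        using M m K q by (auto split: if_splits)
      with run no_run show ?thesis by simp
    next
      case (Suc j)
      obtain q1 A B Z q' where i: "prog ! j = Instr q1 A B Z q'" by (cases "prog ! j")
      have "j < length prog" using fires Suc by (simp add: fires_def net_def)
      with i have mem: "Instr q1 A B Z q' \<in> set prog" by (metis nth_mem)
      from wf[OF this] have w: "q1 \<in> {K..e}" "q' \<in> {K..e}" "set_mset A \<subseteq> {0<..<K}"
        "set_mset B \<subseteq> {0<..<K}" "Z \<subseteq> {0<..<K}"
        by (auto simp: wf_instr_def)
      from fires i Suc obtain M1 where M1: "M1 + weighted q1 A = M"
        and M': "M' = filter_mset (\<lambda>x. x \<notin> Z) M1 + weighted q' B"
        by (auto simp: fires_def net_def)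
      \<comment> \<open>From \<open>K\<close> on, the only token is the label token; the instruction
        that fires must therefore start at \<open>q\<close>.\<close>
      have q_cnt: "count M x = (if x = q then 1 else 0)" if "K \<le> x" for x
        using that M m K by (force simp: not_in_iff[symmetric])
      have "count M q1 \<ge> 1" using M1 by (auto simp: weighted_def)
      with q_cnt[of q1] w(1) have "q1 = q" by (auto split: if_splits)
      have sub: "A \<subseteq># m"
      proof (rule mset_subset_eqI)
        fix x
        show "count A x \<le> count m x"
        proof (cases "x \<in># A")
          case True
          then have "x \<noteq> 0" "x \<noteq> q" using w q by auto
          then show ?thesis
            using arg_cong[OF M1, of "\<lambda>X. count X x"] by (auto simp: M weighted_def split: if_splits)
        qed (simp add: not_in_iff)
      qed
      then obtain m1 where m1: "m = m1 + A" by (metis subset_mset.diff_add)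
      have "M1 = m1 + replicate_mset (size m1 + d) 0"
      proof -
        have "M = m1 + replicate_mset (size m1 + d) 0 + weighted q1 A"
          unfolding M weighted_def m1 \<open>q1 = q\<close> by (rule multiset_eqI) simp
        with M1 show ?thesis by simp
      qed
      \<comment> \<open>The tokens destroyed by the reset are still counted in place 0, so they join
        the excess.\<close>
      define F d' where "F = filter_mset (\<lambda>x. x \<notin> Z) m1"
        and "d' = d + size (filter_mset (\<lambda>x. x \<in> Z) m1)"
      have "size m1 = size F + size (filter_mset (\<lambda>x. x \<in> Z) m1)"
        unfolding F_def by (metis add.commute multiset_partition size_union)
      then have "M' = add_mset q' (F + B + replicate_mset (size (F + B) + d') 0)"
        unfolding M' \<open>M1 = _\<close> weighted_def using w(5)
        by (intro multiset_eqI) (auto simp: F_def d'_def)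
      moreover have "set_mset (F + B) \<subseteq> {0<..<K}"
        using m m1 w by (auto simp: F_def)
      moreover have "(step (set prog))\<^sup>*\<^sup>* (p, m0) (q', F + B)" if "d' = 0"
      proof -
        \<comment> \<open>With no excess the reset counters were already empty, which is precisely
          the zero test.\<close>
        from that have "d = 0" "set_mset m1 \<inter> Z = {}" by (auto simp: d'_def)
        moreover from this(2) have "F = m1" unfolding F_def by (intro filter_mset_ident) auto
        ultimately have "step (set prog) (q, m) (q', F + B)"
          using step.step[OF mem] by (simp add: m1 \<open>q1 = q\<close>)
        with run[OF \<open>d = 0\<close>] show ?thesis by simp
      qed
      ultimately show ?thesis using w(2) unfolding inv_def by blast
    qed
  qed
  from cov obtain M where M: "(\<lambda>M M'. \<exists>t. fires ?N t M M')\<^sup>*\<^sup>* (weighted p m0) M" "Suc e \<in># M"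
    by (auto simp: coverable_def reachable_def net_def)
  from M(1) have "inv M"
  proof (induction rule: rtranclp_induct)
    case base
    show ?case
      unfolding inv_def weighted_def using K by (intro exI[of _ p] exI[of _ m0] exI[of _ 0]) auto
  qed (use inv_step in blast)
  \<comment> \<open>Under \<open>inv\<close> every token lies on a place up to \<open>e\<close>, so
    the target place \<open>Suc e\<close> is unmarked.\<close>
  with M(2) K show False by (auto simp: inv_def split: if_splits)
qed

section \<open>The code of an instance as a recursive function\<close>

definition rf_add :: recfun where
  "rf_add = Prec (Proj 0) (Comp Succ [Proj 1])"

definition rf_triangle :: recfun where
  "rf_triangle = Prec Zero (Comp rf_add [Proj 1, Comp Succ [Proj 0]])"

text \<open>Cantor pairing as in \<open>prod_encode\<close>:
  \<open>triangle (x + y) + x\<close>.\<close>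

definition rf_pair :: "recfun \<Rightarrow> recfun \<Rightarrow> recfun" where
  "rf_pair f g = Comp rf_add [Comp rf_triangle [Comp rf_add [f, g]], f]"

definition rf_cons :: "recfun \<Rightarrow> recfun \<Rightarrow> recfun" where
  "rf_cons f g = Comp Succ [rf_pair f g]"

section \<open>Evaluating the coding functions\<close>

lemma rec_eval_Proj: "i < length xs \<Longrightarrow> y = xs ! i \<Longrightarrow> rec_eval (Proj i) xs y"
  using rec_eval.Proj by blast

lemma rec_eval_Comp1: "rec_eval g xs y \<Longrightarrow> rec_eval f [y] z \<Longrightarrow> rec_eval (Comp f [g]) xs z"
  by (rule rec_eval.Comp[of _ _ "[y]"]) auto

lemma rec_eval_Comp2:
  "rec_eval g xs y \<Longrightarrow> rec_eval h xs z \<Longrightarrow> rec_eval f [y, z] u \<Longrightarrow> rec_eval (Comp f [g, h]) xs u"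
  by (rule rec_eval.Comp[of _ _ "[y, z]"]) auto

lemma rec_eval_add: "rec_eval rf_add [x, y] (x + y)"
proof (induction x)
  case 0
  show ?case unfolding rf_add_def by (auto intro!: rec_eval.Prec_0 rec_eval_Proj)
next
  case (Suc x)
  have "rec_eval (Comp Succ [Proj 1]) [x, x + y, y] (Suc (x + y))"
    by (rule rec_eval_Comp1[OF rec_eval_Proj rec_eval.Succ]) auto
  with Suc show ?case unfolding rf_add_def by (auto intro: rec_eval.Prec_Suc)
qed

lemma rec_eval_triangle: "rec_eval rf_triangle [x] (triangle x)"
proof (induction x)
  case 0
  show ?case unfolding rf_triangle_def by (auto intro!: rec_eval.Prec_0 rec_eval.Zero)
next
  case (Suc x)
  have "rec_eval (Comp Succ [Proj 0]) [x, triangle x] (Suc x)"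
    by (rule rec_eval_Comp1[OF rec_eval_Proj rec_eval.Succ]) auto
  then have "rec_eval (Comp rf_add [Proj 1, Comp Succ [Proj 0]]) [x, triangle x] (triangle (Suc x))"
    using rec_eval_add[of "triangle x" "Suc x"] by (auto intro!: rec_eval_Comp2 rec_eval_Proj)
  with Suc show ?case unfolding rf_triangle_def by (auto intro: rec_eval.Prec_Suc)
qed

lemma rec_eval_sum:
  "rec_eval f xs y \<Longrightarrow> rec_eval g xs z \<Longrightarrow> rec_eval (Comp rf_add [f, g]) xs (y + z)"
  by (rule rec_eval_Comp2[OF _ _ rec_eval_add])

lemma rec_eval_pair:
  "rec_eval f xs y \<Longrightarrow> rec_eval g xs z \<Longrightarrow> rec_eval (rf_pair f g) xs (prod_encode (y, z))"
  unfolding rf_pair_def prod_encode_def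
  by (auto intro!: rec_eval_sum rec_eval_Comp1[OF _ rec_eval_triangle])

lemma rec_eval_cons:
  "rec_eval f xs y \<Longrightarrow> rec_eval g xs (list_encode ys) \<Longrightarrow>
     rec_eval (rf_cons f g) xs (list_encode (y # ys))"
  unfolding rf_cons_def by (auto intro!: rec_eval_Comp1[OF rec_eval_pair rec_eval.Succ])

text \<open>
  The arguments are the codes of the places, of the transitions, of the initial marking after the
  first five places and of the target marking.
\<close>

definition rf_instance :: recfun where
  "rf_instance =
     (let p = Proj 0; t = Proj 1; r = Proj 2; d = Proj 3;
          s = Comp rf_add [p, Comp rf_add [t, Comp rf_add [r, d]]];
          i = rf_cons s (rf_cons p (rf_cons t (rf_cons r (rf_cons d r))))
      in rf_pair
        (rf_cons p (rf_cons t (rf_cons Zero (rf_cons Zero (rf_cons i Zero))))) d)"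

text \<open>The two zeros code the inhibitor arc. The marking vector starts with the sum place and
  the four inputs; its tail \<open>rs\<close> enters only by its code. \<open>Zero\<close> also ends
  lists, as the empty list has code 0.\<close>

lemma rec_eval_instance:
  "rec_eval rf_instance [p, t, list_encode rs, d]
     (prod_encode (list_encode [p, t, 0, 0,
        list_encode ([p + (t + (list_encode rs + d)), p, t, list_encode rs, d] @ rs)], d))"
  unfolding rf_instance_def Let_def append.simps
  by (intro rec_eval_pair rec_eval_cons rec_eval_sum)
    (auto intro!: rec_eval_Proj rec_eval.Zero intro: rec_eval.Zero[folded list_encode.simps(1)])

section \<open>The self-referential net\<close>

theorem theorem7p10:
  "\<not> decidable_problem
       {(N :: nat_net, m). reset_inhibitor_net N \<and> is_marking N m}
       (\<lambda>(N, m). coverable N m)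
       encode_instance"
proof
  assume "decidable_problem {(N :: nat_net, m). reset_inhibitor_net N \<and> is_marking N m}
    (\<lambda>(N, m). coverable N m) encode_instance"
  then obtain f where f: "\<And>N m. reset_inhibitor_net N \<Longrightarrow> is_marking N m \<Longrightarrow>
      rec_eval f [encode_instance (N, m)] (if coverable N m then 1 else 0)"
    unfolding decidable_problem_def by fastforce
  \<comment> \<open>Inputs are in counters 0 to 3, the answer in 4, work space from 5 on. Erasing
    the inputs leaves all counters empty exactly if the answer is 0.\<close>
  define c where "c = compute (Comp f [rf_instance]) [0, 1, 2, 3] 4 5 ;; clear_all [0, 1, 2, 3]"
  obtain k where k: "counters c \<subseteq> {..<k}"
    using finite_counters[of c] by (auto simp: finite_nat_set_iff_bounded)
  \<comment> \<open>Shifted counters of \<open>c\<close> are at most \<open>k\<close>; the summand 6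
    keeps places 0 to 5 (sum, inputs, answer) below the labels.\<close>
  define K where "K = k + 6"
  define e where "e = exit_label c K"
  define prog where "prog = instrs c K"
  have "K \<le> e" unfolding e_def by (rule exit_label_ge)
  have wf: "wf_instr K e i" if "i \<in> set prog" for i
    using that k unfolding prog_def e_def by (intro wf_instrs[of K K c]) (auto simp: K_def)
  \<comment> \<open>These four numbers do not depend on \<open>m\<close>: transition codes ignore
    the initial marking, and from place 5 on that marking is just the label token \<open>K\<close>.
    Storing them in \<open>m\<close> is thus not circular.\<close>
  define p where "p = list_encode [0..<e + 2]"
  define t where
    "t = list_encode (map (encode_transition (net prog e {#})) [0..<Suc (length prog)])"
  define rs where "rs = map (count {#K#}) [5..<e + 2]"
  define d where "d = list_encode (map (count {#Suc e#}) [0..<e + 2])"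
  define m :: "nat multiset" where "m = replicate_mset p 0 + replicate_mset t 1 +
    replicate_mset (list_encode rs) 2 + replicate_mset d 3"
  define N where "N = net prog e (weighted K (image_mset Suc m))"
  have places: "sorted_list_of_set (places N) = [0..<e + 2]"
    and transitions: "sorted_list_of_set (transitions N) = [0..<Suc (length prog)]"
    by (simp_all add: N_def net_def lessThan_atLeast0 del: upt_Suc)
  have inh: "inhibitor N = (0, 0)" by (simp add: N_def net_def)
  have trans: "encode_transition N = encode_transition (net prog e {#})"
    by (intro ext) (simp add: encode_transition_def encode_marking_def N_def net_def)
  have init: "map (count (init N)) [0..<e + 2] =
      [p + (t + (list_encode rs + d)), p, t, list_encode rs, d] @ rs"
  proof -
    have "[0..<e + 2] = [0, 1, 2, 3, 4] @ [5..<e + 2]"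
      using \<open>K \<le> e\<close> upt_add_eq_append[of 0 5 "e - 3"] by (simp add: K_def upt_rec[of _ 5])
    moreover have "map (count (init N)) [5..<e + 2] = rs"
      unfolding rs_def by (auto simp: N_def net_def weighted_def m_def)
    moreover have "map (count (init N)) [0, 1, 2, 3, 4] =
        [p + (t + (list_encode rs + d)), p, t, list_encode rs, d]"
      by (simp add: N_def net_def weighted_def m_def K_def)
    ultimately show ?thesis by (metis map_append)
  qed
  have code: "encode_instance (N, {#Suc e#}) =
     prod_encode (list_encode [p, t, 0, 0,
        list_encode ([p + (t + (list_encode rs + d)), p, t, list_encode rs, d] @ rs)], d)"
    by (simp only: encode_instance_def encode_net_def encode_marking_def places transitions inh
        trans init p_def[symmetric] t_def[symmetric] d_def[symmetric] case_prod_conv fst_conv snd_conv)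
  have wf_net: "reset_inhibitor_net N"
    unfolding N_def
    by (rule reset_inhibitor_net_net[OF wf \<open>K \<le> e\<close>])
      (use \<open>K \<le> e\<close> in \<open>auto simp: weighted_def m_def K_def split: if_splits\<close>)
  \<comment> \<open>\<open>v\<close> is the answer of \<open>f\<close> about \<open>N\<close>
    itself, which \<open>c\<close> computes from the numbers stored in \<open>m\<close>.\<close>
  define v :: nat where "v = (if coverable N {#Suc e#} then 1 else 0)"
  have "rec_eval f [encode_instance (N, {#Suc e#})] v"
    unfolding v_def by (rule f[OF wf_net]) (simp add: is_marking_def N_def net_def)
  then have "rec_eval (Comp f [rf_instance]) [p, t, list_encode rs, d] v"
    unfolding code by (rule rec_eval_Comp1[OF rec_eval_instance])
  then have "exec (compute (Comp f [rf_instance]) [0, 1, 2, 3] 4 5) m (m + replicate_mset v 4)"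
    by (intro computesD[OF computes_rec_eval]) (auto simp: m_def split: if_splits)
  moreover have "filter_mset (\<lambda>x. x \<notin> set [0, 1, 2, 3]) (m + replicate_mset v 4) = replicate_mset v 4"
    by (rule multiset_eqI) (auto simp: m_def)
  ultimately have "exec c m (replicate_mset v 4)"
    unfolding c_def using exec_clear_all[of "[0, 1, 2, 3]" "m + replicate_mset v 4"]
    by (auto intro: exec.Seq)
  from steps_exec[OF this, of K "set prog"]
  have run: "(step (set prog))\<^sup>*\<^sup>* (K, image_mset Suc m) (e, replicate_mset v 5)"
    by (simp add: prog_def e_def)
  have stuck: "\<not> step (set prog) (e, u) s" for u s
    unfolding prog_def e_def using step_source by blast
  have "coverable N {#Suc e#} \<longleftrightarrow> (step (set prog))\<^sup>*\<^sup>* (K, image_mset Suc m) (e, {#})"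
  proof
    assume "coverable N {#Suc e#}"
    then have cov: "coverable (net prog e (weighted K (image_mset Suc m))) {#Suc e#}"
      by (simp only: N_def)
    show "(step (set prog))\<^sup>*\<^sup>* (K, image_mset Suc m) (e, {#})"
      by (rule net_sound[OF wf _ _ _ cov])
        (use \<open>K \<le> e\<close> in \<open>auto simp: K_def m_def split: if_splits\<close>)
  next
    assume run: "(step (set prog))\<^sup>*\<^sup>* (K, image_mset Suc m) (e, {#})"
    show "coverable N {#Suc e#}"
      unfolding N_def
      by (rule net_complete[OF wf _ run]) (use \<open>K \<le> e\<close> in \<open>auto simp: K_def\<close>)
  qed
  \<comment> \<open>The label \<open>e\<close> has no instructions, so by determinism every run
    reaching it ends with exactly \<open>v\<close> tokens in place 5.\<close>
  also have "\<dots> \<longleftrightarrow> v = 0"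
  proof
    assume "(step (set prog))\<^sup>*\<^sup>* (K, image_mset Suc m) (e, {#})"
    from steps_stuck_unique[OF step_deterministic run[unfolded prog_def] _ this[unfolded prog_def]]
    show "v = 0" using stuck[unfolded prog_def] by auto
  next
    assume "v = 0"
    with run show "(step (set prog))\<^sup>*\<^sup>* (K, image_mset Suc m) (e, {#})" by simp
  qed
  \<comment> \<open>\<open>v = 0\<close> means that \<open>N\<close> does not cover its target,
    contrary to the equivalence.\<close>
  finally show False by (auto simp: v_def split: if_splits)
qed

end
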